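(* Let $n\ge 3$ and let $\Gamma$ be a signed graph on the $2n$ vertices $V_1\cup V_2$, $V_1=\{u_1,\dots,u_n\}$, $V_2=\{v_1,\dots,v_n\}$, whose only edges are the positive edges of the path $u_1u_2\cdots u_n$ and the positive edges of the path $v_1v_2\cdots v_n$ (so there are no edges between $V_1$ and $V_2$). Let $\Gamma_1$ be obtained from $\Gamma$ by adding a positive edge $u_1u_n$, a negative edge $u_1v_1$ and a positive edge $u_1v_n$. Then: (i) $\Gamma_1$ and its partial transpose $\Gamma_1^{\tau}$ (with respect to the labelled partition $V_1,V_2$) are non-isomorphic and Laplacian cospectral; (ii) let $\Gamma_2$ be obtained from $\Gamma_1$ by changing the sign of the edge $u_{n-1}u_n$ to negative and the sign of the edge $u_1v_1$ to positive, and let $\Gamma_3$ be obtained from $\Gamma_1^{\tau}$ by changing the sign of the edge $u_{n-1}u_n$ to negative. Then $\Gamma_2$ and $\Gamma_3$ are non-isomorphic and Laplacian cospectral.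
   Context: A signed graph $\Gamma=(G,\sigma)$ is a simple graph $G$ with a sign function $\sigma:E(G)\to\{1,-1\}$. Its adjacency matrix $A(\Gamma)=(a_{ij})$ has $a_{ij}=\sigma(v_iv_j)$ if $v_iv_j\in E(G)$ and $0$ otherwise; its Laplacian matrix is $L(\Gamma)=D(G)-A(\Gamma)$, where $D(G)$ is the diagonal matrix of vertex degrees of $G$. Two signed graphs are Laplacian cospectral if their Laplacian matrices have the same spectrum (with multiplicities). Two signed graphs are isomorphic if there is an isomorphism of the underlying graphs preserving the signs of edges. Partial transpose: let $\Gamma$ be a signed graph whose vertex set is the disjoint union of $V_1=\{u_1,\dots,u_n\}$ and $V_2=\{v_1,\dots,v_n\}$ (with these labellings fixed). The partial transpose $\Gamma^{\tau}$ is the signed graph on the same vertex set in which all edges with both ends in $V_1$ or both ends in $V_2$ are kept with their signs, all edges between $V_1$ and $V_2$ are removed, and for every edge $u_iv_j$ of $\Gamma$ with sign $s$, an edge $u_jv_i$ with sign $s$ is added. (Thus $u_jv_i$ is an edge of $\Gamma^\tau$ with sign $s$ iff $u_iv_j$ is an edge of $\Gamma$ with sign $s$; edges $u_iv_i$ are unchanged.) *)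

theory Defs
  imports "Jordan_Normal_Form.Char_Poly"
begin

text \<open>A signed graph on the 2n vertices 0..<2n is encoded by a function
  A :: nat => nat => int with A x y = sign of edge xy (1 or -1), or 0 if no edge.
  Vertex labelling: u_i = i - 1 and v_i = n + i - 1 for i = 1..n, so
  V1 = {0..<n}, V2 = {n..<2n}.\<close>

definition uu :: "nat \<Rightarrow> nat" where "uu i = i - 1"
definition vv :: "nat \<Rightarrow> nat \<Rightarrow> nat" where "vv n i = n + i - 1"

definition set_edge :: "(nat \<Rightarrow> nat \<Rightarrow> int) \<Rightarrow> nat \<Rightarrow> nat \<Rightarrow> int \<Rightarrow> nat \<Rightarrow> nat \<Rightarrow> int" where
  "set_edge A a b s = (\<lambda>x y. if (x = a \<and> y = b) \<or> (x = b \<and> y = a) then s else A x y)"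

definition sg_laplacian :: "nat \<Rightarrow> (nat \<Rightarrow> nat \<Rightarrow> int) \<Rightarrow> real mat" where
  "sg_laplacian n A = mat (2*n) (2*n)
     (\<lambda>(i,j). (if i = j then real (card {k \<in> {0..<2*n}. A i k \<noteq> 0}) else 0) - real_of_int (A i j))"

definition lap_cospectral :: "nat \<Rightarrow> (nat \<Rightarrow> nat \<Rightarrow> int) \<Rightarrow> (nat \<Rightarrow> nat \<Rightarrow> int) \<Rightarrow> bool" where
  "lap_cospectral n A B \<longleftrightarrow> char_poly (sg_laplacian n A) = char_poly (sg_laplacian n B)"

definition sg_iso :: "nat \<Rightarrow> (nat \<Rightarrow> nat \<Rightarrow> int) \<Rightarrow> (nat \<Rightarrow> nat \<Rightarrow> int) \<Rightarrow> bool" where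
  "sg_iso n A B \<longleftrightarrow> (\<exists>f. bij_betw f {0..<2*n} {0..<2*n} \<and>
      (\<forall>x\<in>{0..<2*n}. \<forall>y\<in>{0..<2*n}. B (f x) (f y) = A x y))"

text \<open>Partial transpose w.r.t. V1 = {0..<n} (u_i), V2 = {n..<2n} (v_i):
  u_j v_i gets the sign of u_i v_j.\<close>
definition partial_transpose :: "nat \<Rightarrow> (nat \<Rightarrow> nat \<Rightarrow> int) \<Rightarrow> nat \<Rightarrow> nat \<Rightarrow> int" where
  "partial_transpose n A = (\<lambda>x y.
     if x < n \<and> n \<le> y \<and> y < 2*n then A (y - n) (x + n)
     else if n \<le> x \<and> x < 2*n \<and> y < n then A (y + n) (x - n)
     else A x y)"

definition two_paths :: "nat \<Rightarrow> nat \<Rightarrow> nat \<Rightarrow> int" where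
  "two_paths n = (\<lambda>x y. if x < 2*n \<and> y < 2*n \<and> ((x < n \<and> y < n) \<or> (n \<le> x \<and> n \<le> y))
                          \<and> (x = y + 1 \<or> y = x + 1) then 1 else 0)"

definition Gamma1 :: "nat \<Rightarrow> nat \<Rightarrow> nat \<Rightarrow> int" where
  "Gamma1 n = set_edge (set_edge (set_edge (two_paths n)
      (uu 1) (uu n) 1) (uu 1) (vv n 1) (-1)) (uu 1) (vv n n) 1"

definition Gamma2 :: "nat \<Rightarrow> nat \<Rightarrow> nat \<Rightarrow> int" where
  "Gamma2 n = set_edge (set_edge (Gamma1 n) (uu (n-1)) (uu n) (-1)) (uu 1) (vv n 1) 1"

definition Gamma3 :: "nat \<Rightarrow> nat \<Rightarrow> nat \<Rightarrow> int" where
  "Gamma3 n = set_edge (partial_transpose n (Gamma1 n)) (uu (n-1)) (uu n) (-1)"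

end

theory Submission
  imports Defs
begin

text \<open>
  Write the Laplacian as the sum of the rank-one matrices \<open>w w\<^sup>T\<close> with \<open>w = e\<^sub>a - s e\<^sub>b\<close> over
  all edges \<open>ab\<close> of sign \<open>s\<close>. The two positive paths contribute the same matrix \<open>P\<close> to both
  graphs, and \<open>P\<close> is invariant under exchanging the two paths and under reversing the order of all
  vertices. Let \<open>S\<close> and \<open>R\<close> be the permutation matrices of these two involutions. For \<open>e = \<plusminus>1\<close> the
  matrix \<open>Q = (1 + S + e R - e R S) / 2\<close> is an involution commuting with \<open>P\<close>, and it fixes
  \<open>e\<^bsub>u1\<^esub> - e e\<^bsub>un\<^esub>\<close> and \<open>e\<^bsub>u1\<^esub> + e\<^bsub>v1\<^esub>\<close> while sending \<open>e\<^bsub>u1\<^esub> - e e\<^bsub>vn\<^esub>\<close> to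
  \<open>- e (e\<^bsub>un\<^esub> - e e\<^bsub>v1\<^esub>)\<close>. So \<open>Q\<close> conjugates one Laplacian into the other. The case \<open>e = 1\<close> is
  part (i); the case \<open>e = -1\<close> is part (ii) up to switching. Non-isomorphism is seen from the
  maximum degrees, which are 4 and 3.
\<close>

section \<open>Similarity through an involution, and entries of signed Laplacians\<close>

text \<open>An involution is its own inverse, so \<open>Q * A = B * Q\<close> gives
  \<open>B = Q * A * Q\<close>, a similarity. The hypotheses are sums over entries because
  \<open>q\<close> will be given by a formula rather than as a matrix.\<close>

lemma char_poly_eq_if_intertwined_by_involution:
  fixes A B :: "'a :: field mat"
  assumes A: "A \<in> carrier_mat m m" and B: "B \<in> carrier_mat m m"
    and invol: "\<And>i j. i < m \<Longrightarrow> j < m \<Longrightarrow> (\<Sum>k<m. q i k * q k j) = of_bool (i = j)"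
    and intertw: "\<And>i j. i < m \<Longrightarrow> j < m \<Longrightarrow>
      (\<Sum>k<m. q i k * A $$ (k, j)) = (\<Sum>k<m. B $$ (i, k) * q k j)"
  shows "char_poly A = char_poly B"
proof -
  define Q where "Q = mat m m (\<lambda>(i, j). q i j)"
  have Q: "Q \<in> carrier_mat m m" by (simp add: Q_def)
  have QQ: "Q * Q = 1\<^sub>m m"
    by (rule eq_matI) (use invol in \<open>auto simp: Q_def scalar_prod_def atLeast0LessThan\<close>)
  have QA: "Q * A = B * Q"
    by (rule eq_matI) (use intertw A B in \<open>auto simp: Q_def scalar_prod_def atLeast0LessThan\<close>)
  have "B = B * (Q * Q)" using B by (simp add: QQ)
  also have "\<dots> = Q * A * Q" using A B Q by (simp add: QA)
  finally have "similar_mat_wit B A Q Q"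
    using A B Q QQ by (simp add: similar_mat_wit_def)
  then show ?thesis
    by (metis char_poly_similar similar_mat_def)
qed

lemma sg_laplacian_carrier [simp]: "sg_laplacian n A \<in> carrier_mat (2*n) (2*n)"
  by (simp add: sg_laplacian_def)

lemma sg_laplacian_index:
  "i < 2*n \<Longrightarrow> j < 2*n \<Longrightarrow> sg_laplacian n A $$ (i, j) =
     (if i = j then real (card {k. k < 2*n \<and> A i k \<noteq> 0}) else 0) - real_of_int (A i j)"
  by (simp add: sg_laplacian_def)

lemma sg_laplacian_cong:
  assumes "\<And>i j. i < 2*n \<Longrightarrow> j < 2*n \<Longrightarrow> A i j = B i j"
  shows "sg_laplacian n A = sg_laplacian n B"
proof (rule eq_matI)
  fix i j assume ij: "i < dim_row (sg_laplacian n B)" "j < dim_col (sg_laplacian n B)"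
  then have "{k. k < 2*n \<and> A i k \<noteq> 0} = {k. k < 2*n \<and> B i k \<noteq> 0}"
    using assms by (auto simp: sg_laplacian_def)
  then show "sg_laplacian n A $$ (i, j) = sg_laplacian n B $$ (i, j)"
    using ij assms by (auto simp: sg_laplacian_def)
qed (simp_all add: sg_laplacian_def)

text \<open>Conjugation by the diagonal matrix of the signs \<open>s i\<close>, which is its own
  inverse. Nonzero factors leave the support of each row, and hence the degrees, unchanged.\<close>

lemma lap_cospectral_switching:
  fixes s :: "nat \<Rightarrow> int"
  assumes s: "\<And>i. s i * s i = 1"
    and B: "\<And>i j. i < 2*n \<Longrightarrow> j < 2*n \<Longrightarrow> B i j = s i * s j * A i j"
  shows "lap_cospectral n A B"
  unfolding lap_cospectral_def
proof (rule char_poly_eq_if_intertwined_by_involution)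
  let ?q = "\<lambda>i k. if i = k then real_of_int (s i) else 0"
  have ss: "real_of_int (s i) * real_of_int (s i) = 1" for i
    using s by (metis of_int_1 of_int_mult)
  have s0: "s i \<noteq> 0" for i using s[of i] by auto
  fix i j assume ij: "i < 2*n" "j < 2*n"
  have left: "(\<Sum>k<2*n. ?q i k * f k) = real_of_int (s i) * f i" for f :: "nat \<Rightarrow> real"
  proof -
    have "(\<Sum>k<2*n. ?q i k * f k) = (\<Sum>k<2*n. if i = k then real_of_int (s i) * f k else 0)"
      by (rule sum.cong) auto
    then show ?thesis using ij by simp
  qed
  have right: "(\<Sum>k<2*n. f k * ?q k j) = f j * real_of_int (s j)" for f :: "nat \<Rightarrow> real"
  proof -
    have "(\<Sum>k<2*n. f k * ?q k j) = (\<Sum>k<2*n. if k = j then f k * real_of_int (s k) else 0)"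
      by (rule sum.cong) auto
    then show ?thesis using ij by simp
  qed
  show "(\<Sum>k<2*n. ?q i k * ?q k j) = of_bool (i = j)"
    using ss by (simp only: left) simp
  have *: "{k. k < 2*n \<and> B i k \<noteq> 0} = {k. k < 2*n \<and> A i k \<noteq> 0}" if "i < 2*n" for i
    using that s0 by (auto simp: B)
  have "real_of_int (s i) * sg_laplacian n A $$ (i, j) = sg_laplacian n B $$ (i, j) * real_of_int (s j)"
    using ij by (simp add: sg_laplacian_index * B) (simp add: ss)
  then show "(\<Sum>k<2*n. ?q i k * sg_laplacian n A $$ (k, j)) = (\<Sum>k<2*n. sg_laplacian n B $$ (i, k) * ?q k j)"
    by (simp only: left right)
qed simp_all

text \<open>An automorphism \<open>p\<close> maps the neighbourhood of \<open>i\<close> bijectively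
  onto that of \<open>p i\<close>, so the degrees agree as well as the off-diagonal entries.\<close>

lemma sg_laplacian_automorphism:
  assumes bij: "bij_betw p {..<2*n} {..<2*n}"
    and A: "\<And>i j. i < 2*n \<Longrightarrow> j < 2*n \<Longrightarrow> A (p i) (p j) = A i j"
    and ij: "i < 2*n" "j < 2*n"
  shows "sg_laplacian n A $$ (p i, p j) = sg_laplacian n A $$ (i, j)"
proof -
  have p: "p k < 2*n" if "k < 2*n" for k
    using bij_betwE[OF bij] that by blast
  have eq: "p i = p j \<longleftrightarrow> i = j"
    using bij ij by (auto simp: bij_betw_def inj_on_def)
  have img: "p ` {k. k < 2*n \<and> A i k \<noteq> 0} = {k. k < 2*n \<and> A (p i) k \<noteq> 0}"
  proof (intro equalityI image_subsetI subsetI)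
    fix k assume "k \<in> {k. k < 2*n \<and> A i k \<noteq> 0}"
    then show "p k \<in> {k. k < 2*n \<and> A (p i) k \<noteq> 0}" using A[of i k] ij p by simp
  next
    fix k assume "k \<in> {k. k < 2*n \<and> A (p i) k \<noteq> 0}"
    moreover from this obtain l where "l < 2*n" "k = p l"
      using bij by (auto simp: bij_betw_def)
    ultimately show "k \<in> p ` {k. k < 2*n \<and> A i k \<noteq> 0}" using A ij by auto
  qed
  have "inj_on p {k. k < 2*n \<and> A i k \<noteq> 0}"
    using bij by (auto simp: bij_betw_def intro: inj_on_subset)
  from card_image[OF this]
  have "card {k. k < 2*n \<and> A (p i) k \<noteq> 0} = card {k. k < 2*n \<and> A i k \<noteq> 0}"
    unfolding img .
  then show ?thesis
    using ij p[OF ij(1)] p[OF ij(2)] by (simp only: sg_laplacian_index eq A)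
qed

text \<open>The column of a signed incidence matrix that belongs to an edge \<open>ab\<close> of
  sign \<open>s\<close>.\<close>

definition edge_vec :: "nat \<Rightarrow> nat \<Rightarrow> real \<Rightarrow> nat \<Rightarrow> real" where
  "edge_vec a b s i = of_bool (i = a) - s * of_bool (i = b)"

text \<open>On the diagonal, s^2 = 1 accounts for the rise of both degrees by one; off the diagonal,
  -s is the entry of the new edge. The neighbourhoods really grow because \<open>a\<close> and
  \<open>b\<close> were non-adjacent.\<close>

lemma sg_laplacian_set_edge:
  assumes ab: "a < 2*n" "b < 2*n" "a \<noteq> b" and A: "A a b = 0" "A b a = 0"
    and s: "s = 1 \<or> s = -1" and ij: "i < 2*n" "j < 2*n"
  shows "sg_laplacian n (set_edge A a b s) $$ (i, j) =
    sg_laplacian n A $$ (i, j) + edge_vec a b (of_int s) i * edge_vec a b (of_int s) j"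
proof -
  let ?N = "\<lambda>A i. {k. k < 2*n \<and> A i k \<noteq> (0::int)}"
  have "?N (set_edge A a b s) a = insert b (?N A a)" "?N (set_edge A a b s) b = insert a (?N A b)"
    using ab s by (auto simp: set_edge_def)
  then have deg: "card (?N (set_edge A a b s) a) = Suc (card (?N A a))"
    "card (?N (set_edge A a b s) b) = Suc (card (?N A b))"
    using A by auto
  have "?N (set_edge A a b s) i = ?N A i" if "i \<noteq> a" "i \<noteq> b" for i
    using that by (auto simp: set_edge_def)
  moreover have "real_of_int s * real_of_int s = 1" using s by auto
  moreover have "set_edge A a b s i j =
      (if i = a \<and> j = b \<or> i = b \<and> j = a then s else A i j)"
    by (simp add: set_edge_def)
  ultimately show ?thesis
    using ij ab A deg
    by (cases "i = a"; cases "i = b"; cases "j = a"; cases "j = b")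
      (simp_all add: sg_laplacian_index edge_vec_def)
qed

section \<open>The two symmetries of the pair of paths and the involution built from them\<close>

definition swap :: "nat \<Rightarrow> nat \<Rightarrow> nat" where
  "swap n i = (if i < n then i + n else i - n)"

text \<open>In the labelling this exchanges u_i with v_(n+1-i), in particular u_1 with v_n and u_n
  with v_1.\<close>

definition rev_vertex :: "nat \<Rightarrow> nat \<Rightarrow> nat" where
  "rev_vertex n i = 2*n - 1 - i"

lemma swap_rev_simps [simp]:
  assumes "i < 2*n"
  shows "swap n i < 2*n" "rev_vertex n i < 2*n" "swap n (swap n i) = i"
    "rev_vertex n (rev_vertex n i) = i" "swap n (rev_vertex n i) = rev_vertex n (swap n i)"
  using assms by (auto simp: swap_def rev_vertex_def)

text \<open>The entries of Q. It acts as the identity on vectors fixed by S and as e R on vectors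
  negated by S.\<close>

definition reflection :: "nat \<Rightarrow> real \<Rightarrow> nat \<Rightarrow> nat \<Rightarrow> real" where
  "reflection n e i k = (of_bool (k = i) + of_bool (k = swap n i)
     + e * of_bool (k = rev_vertex n i) - e * of_bool (k = rev_vertex n (swap n i))) / 2"

text \<open>S and R commute, so S, R and RS are all involutions and their permutation matrices are
  symmetric.\<close>

lemma reflection_sym:
  assumes "i < 2*n" "k < 2*n"
  shows "reflection n e i k = reflection n e k i"
proof -
  have "k = swap n i \<longleftrightarrow> i = swap n k" "k = rev_vertex n i \<longleftrightarrow> i = rev_vertex n k"
    "k = rev_vertex n (swap n i) \<longleftrightarrow> i = rev_vertex n (swap n k)"
    using assms by (metis swap_rev_simps)+
  then show ?thesis by (simp add: reflection_def eq_commute[of k i])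
qed

lemma sum_reflection_left:
  assumes "i < 2*n"
  shows "(\<Sum>k<2*n. reflection n e i k * f k) =
    (f i + f (swap n i) + e * f (rev_vertex n i) - e * f (rev_vertex n (swap n i))) / 2"
proof -
  have d: "(\<Sum>k<2*n. of_bool (k = a) * f k) = f a" if "a < 2*n" for a
  proof -
    have "(\<Sum>k<2*n. of_bool (k = a) * f k) = (\<Sum>k<2*n. if k = a then f k else 0)"
      by (rule sum.cong) auto
    then show ?thesis using that by simp
  qed
  have "(\<Sum>k<2*n. reflection n e i k * f k) =
     ((\<Sum>k<2*n. of_bool (k = i) * f k) + (\<Sum>k<2*n. of_bool (k = swap n i) * f k)
     + e * (\<Sum>k<2*n. of_bool (k = rev_vertex n i) * f k)
     - e * (\<Sum>k<2*n. of_bool (k = rev_vertex n (swap n i)) * f k)) / 2"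
    unfolding reflection_def sum_distrib_left sum.distrib[symmetric] sum_subtractf[symmetric] sum_divide_distrib
    by (rule sum.cong) (auto simp: algebra_simps)
  then show ?thesis using assms by (simp only: d swap_rev_simps)
qed

lemma sum_reflection_right:
  assumes "j < 2*n"
  shows "(\<Sum>k<2*n. f k * reflection n e k j) =
    (f j + f (swap n j) + e * f (rev_vertex n j) - e * f (rev_vertex n (swap n j))) / 2"
proof -
  have "(\<Sum>k<2*n. f k * reflection n e k j) = (\<Sum>k<2*n. reflection n e j k * f k)"
    using assms by (intro sum.cong) (auto simp: reflection_sym[of _ n j])
  then show ?thesis using assms by (simp add: sum_reflection_left)
qed

text \<open>Write Q = ((1 + S) + e R (1 - S)) / 2. In the square the cross terms vanish because (1 +
  S)(1 - S) = 0, leaving (1 + e^2)/2 + S (1 - e^2)/2.\<close>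

lemma reflection_involution:
  assumes "i < 2*n" "j < 2*n" and e: "e * e = 1"
  shows "(\<Sum>k<2*n. reflection n e i k * reflection n e k j) = of_bool (i = j)"
proof -
  \<comment> \<open>With \<open>i\<close> these form the orbit under the two symmetries, and
    \<open>r\<close> below lists the four rows of Q that belong to it. The orbit may have fewer than
    four elements (for odd \<open>n\<close>, \<open>z = i\<close> at the middle of a path), so the
    computation keeps the indicators as independent terms.\<close>
  define x y z where "x = swap n i" and "y = rev_vertex n i" and "z = rev_vertex n x"
  have lt: "x < 2*n" "y < 2*n" "z < 2*n" "swap n x = i" "rev_vertex n x = z" "swap n y = z"
    "rev_vertex n y = i" "rev_vertex n z = x" "swap n z = y"
    using assms(1) by (simp_all add: x_def y_def z_def)
  have r: "reflection n e i j = (of_bool (j = i) + of_bool (j = x) + e * of_bool (j = y) - e * of_bool (j = z)) / 2"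
    "reflection n e x j = (of_bool (j = x) + of_bool (j = i) + e * of_bool (j = z) - e * of_bool (j = y)) / 2"
    "reflection n e y j = (of_bool (j = y) + of_bool (j = z) + e * of_bool (j = i) - e * of_bool (j = x)) / 2"
    "reflection n e z j = (of_bool (j = z) + of_bool (j = y) + e * of_bool (j = x) - e * of_bool (j = i)) / 2"
    by (simp_all only: reflection_def lt flip: x_def y_def z_def)
  have expand: "((I + X + e * Y - e * Z) / 2 + (X + I + e * Z - e * Y) / 2 + e * ((Y + Z + e * I - e * X) / 2)
      - e * ((Z + Y + e * X - e * I) / 2)) / 2 = I * (1 + e * e) / 2 + X * (1 - e * e) / 2" for I X Y Z
    by (simp add: field_simps)
  have "(\<Sum>k<2*n. reflection n e i k * reflection n e k j) =
      (reflection n e i j + reflection n e x j + e * reflection n e y j - e * reflection n e z j) / 2"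
    using assms(1) by (simp only: sum_reflection_left x_def y_def z_def)
  also have "\<dots> = of_bool (j = i) * (1 + e * e) / 2 + of_bool (j = x) * (1 - e * e) / 2"
    unfolding r by (rule expand)
  finally show ?thesis using e by (cases "i = j") auto
qed

text \<open>This says that P commutes with S and R. For an involutive automorphism p, the entry at
  (p i, j) = (p i, p (p j)) equals the one at (i, p j).\<close>

lemma two_paths_laplacian_symmetry:
  assumes "i < 2*n" "j < 2*n"
  shows "sg_laplacian n (two_paths n) $$ (swap n i, j) = sg_laplacian n (two_paths n) $$ (i, swap n j)"
    and "sg_laplacian n (two_paths n) $$ (rev_vertex n i, j) = sg_laplacian n (two_paths n) $$ (i, rev_vertex n j)"
proof -
  have "bij_betw (swap n) {..<2*n} {..<2*n}" "bij_betw (rev_vertex n) {..<2*n} {..<2*n}"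
    by (rule bij_betw_byWitness[where f' = "swap n"], auto,
        rule bij_betw_byWitness[where f' = "rev_vertex n"], auto)
  moreover have "two_paths n (swap n i) (swap n j) = two_paths n i j" if "i < 2*n" "j < 2*n" for i j
  proof -
    have "swap n i < n \<longleftrightarrow> n \<le> i" "n \<le> swap n i \<longleftrightarrow> i < n"
      "swap n j < n \<longleftrightarrow> n \<le> j" "n \<le> swap n j \<longleftrightarrow> j < n"
      using that by (auto simp: swap_def)
    \<comment> \<open>Only within one path: the consecutive numbers n - 1 and n go to 2n - 1 and
      0.\<close>
    moreover have "swap n i = swap n j + 1 \<longleftrightarrow> i = j + 1" "swap n j = swap n i + 1 \<longleftrightarrow> j = i + 1"
      if "i < n \<longleftrightarrow> j < n"
      using that by (auto simp: swap_def)
    ultimately show ?thesis using that unfolding two_paths_def by (intro if_cong) auto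
  qed
  moreover have "two_paths n (rev_vertex n i) (rev_vertex n j) = two_paths n i j"
    if "i < 2*n" "j < 2*n" for i j
  proof -
    have "rev_vertex n i < n \<longleftrightarrow> n \<le> i" "n \<le> rev_vertex n i \<longleftrightarrow> i < n"
      "rev_vertex n j < n \<longleftrightarrow> n \<le> j" "n \<le> rev_vertex n j \<longleftrightarrow> j < n"
      "rev_vertex n i = rev_vertex n j + 1 \<longleftrightarrow> j = i + 1"
      "rev_vertex n j = rev_vertex n i + 1 \<longleftrightarrow> i = j + 1"
      using that by (auto simp: rev_vertex_def)
    then show ?thesis using that unfolding two_paths_def by (intro if_cong) auto
  qed
  ultimately show "sg_laplacian n (two_paths n) $$ (swap n i, j) = sg_laplacian n (two_paths n) $$ (i, swap n j)"
    "sg_laplacian n (two_paths n) $$ (rev_vertex n i, j) = sg_laplacian n (two_paths n) $$ (i, rev_vertex n j)"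
    using assms sg_laplacian_automorphism[of "swap n" n "two_paths n" i "swap n j"]
      sg_laplacian_automorphism[of "rev_vertex n" n "two_paths n" i "rev_vertex n j"]
    by simp_all
qed

section \<open>Cospectrality of the model graphs\<close>

text \<open>The labels 0, n - 1, n, 2n - 1 are u_1, u_n, v_1, v_n, so two cycles share the vertex
  u_1. The sign \<open>e\<close> covers both parts of the theorem at once.\<close>

definition two_cycles :: "nat \<Rightarrow> int \<Rightarrow> nat \<Rightarrow> nat \<Rightarrow> int" where
  "two_cycles n e = set_edge (set_edge (set_edge (two_paths n) 0 (n-1) e) 0 n (-1)) 0 (2*n-1) e"

definition two_cycles_transposed :: "nat \<Rightarrow> int \<Rightarrow> nat \<Rightarrow> nat \<Rightarrow> int" where
  "two_cycles_transposed n e =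
     set_edge (set_edge (set_edge (two_paths n) 0 (n-1) e) 0 n (-1)) (n-1) n e"

lemma two_cycles_cospectral:
  fixes e :: int
  assumes n: "n \<ge> 3" and e: "e = 1 \<or> e = -1"
  shows "lap_cospectral n (two_cycles n e) (two_cycles_transposed n e)"
  unfolding lap_cospectral_def
proof (rule char_poly_eq_if_intertwined_by_involution)
  let ?e = "real_of_int e"
  let ?P = "sg_laplacian n (two_paths n)"
  let ?q = "reflection n ?e"
  define w1 w2 w3 w4 where w: "w1 = edge_vec 0 (n-1) ?e" "w2 = edge_vec 0 n (-1)"
    "w3 = edge_vec 0 (2*n-1) ?e" "w4 = edge_vec (n-1) n ?e"
  have ee: "?e * ?e = 1" using e by auto
  fix i j assume ij: "i < 2*n" "j < 2*n"
  show "(\<Sum>k<2*n. ?q i k * ?q k j) = of_bool (i = j)"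
    using ij ee by (rule reflection_involution)
  have L: "sg_laplacian n (two_cycles n e) $$ (i, j) = ?P $$ (i, j) + w1 i * w1 j + w2 i * w2 j + w3 i * w3 j"
    "sg_laplacian n (two_cycles_transposed n e) $$ (i, j) = ?P $$ (i, j) + w1 i * w1 j + w2 i * w2 j + w4 i * w4 j"
    if "i < 2*n" "j < 2*n" for i j
  proof -
    \<comment> \<open>The edges are added one at a time, and each must be absent before; u_1 and u_n
      are non-adjacent in their path because n >= 3. Both graphs pass through \<open>?A2\<close> and
      differ only in the last edge.\<close>
    let ?A1 = "set_edge (two_paths n) 0 (n-1) e" and ?A2 = "set_edge (set_edge (two_paths n) 0 (n-1) e) 0 n (-1)"
    have non_edges: "two_paths n 0 (n-1) = 0" "two_paths n (n-1) 0 = 0" "?A1 0 n = 0" "?A1 n 0 = 0"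
      "?A2 0 (2*n-1) = 0" "?A2 (2*n-1) 0 = 0" "?A2 (n-1) n = 0" "?A2 n (n-1) = 0"
      using n by (auto simp: set_edge_def two_paths_def)
    have bounds: "0 < 2*n" "n < 2*n" "n - 1 < 2*n" "2*n-1 < 2*n" "0 \<noteq> n - 1" "0 \<noteq> 2*n-1" "n - 1 \<noteq> n"
      using n by auto
    have 1: "sg_laplacian n ?A1 $$ (i, j) = ?P $$ (i, j) + w1 i * w1 j"
      unfolding w by (rule sg_laplacian_set_edge) (fact bounds non_edges e that)+
    have 2: "sg_laplacian n ?A2 $$ (i, j) = sg_laplacian n ?A1 $$ (i, j) + w2 i * w2 j"
      using sg_laplacian_set_edge[of 0 n n ?A1 "-1" i j] n that non_edges by (simp add: w)
    have 3: "sg_laplacian n (two_cycles n e) $$ (i, j) = sg_laplacian n ?A2 $$ (i, j) + w3 i * w3 j"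
      unfolding w two_cycles_def by (rule sg_laplacian_set_edge) (fact bounds non_edges e that)+
    have 4: "sg_laplacian n (two_cycles_transposed n e) $$ (i, j) = sg_laplacian n ?A2 $$ (i, j) + w4 i * w4 j"
      unfolding w two_cycles_transposed_def by (rule sg_laplacian_set_edge) (fact bounds non_edges e that)+
    show "sg_laplacian n (two_cycles n e) $$ (i, j) = ?P $$ (i, j) + w1 i * w1 j + w2 i * w2 j + w3 i * w3 j"
      "sg_laplacian n (two_cycles_transposed n e) $$ (i, j) = ?P $$ (i, j) + w1 i * w1 j + w2 i * w2 j + w4 i * w4 j"
      using 1 2 3 4 by simp_all
  qed
  \<comment> \<open>The negative sign of u_1v_1 makes \<open>w2\<close> fixed by S. The
    S-antisymmetric part of \<open>w1\<close> is fixed by e R and that of \<open>w3\<close> is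
    negated by it, so Q fixes \<open>w1\<close> and sends \<open>w3\<close> to S \<open>w3\<close>,
    which is - e \<open>w4\<close>.\<close>
  have Qw: "(\<Sum>k<2*n. ?q i k * w1 k) = w1 i" "(\<Sum>k<2*n. ?q i k * w2 k) = w2 i"
      "(\<Sum>k<2*n. ?q i k * w3 k) = - ?e * w4 i" "(\<Sum>k<2*n. ?q i k * w4 k) = - ?e * w3 i"
    if "i < 2*n" for i
  proof -
    have swap: "swap n i = 0 \<longleftrightarrow> i = n" "swap n i = n - 1 \<longleftrightarrow> i = 2*n-1"
      "swap n i = n \<longleftrightarrow> i = 0" "swap n i = 2*n-1 \<longleftrightarrow> i = n - 1"
      using that n by (auto simp: swap_def)
    have rev: "rev_vertex n i = 0 \<longleftrightarrow> i = 2*n-1" "rev_vertex n i = n - 1 \<longleftrightarrow> i = n"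
      "rev_vertex n i = n \<longleftrightarrow> i = n - 1" "rev_vertex n i = 2*n-1 \<longleftrightarrow> i = 0"
      if "i < 2*n" for i
      using that n by (auto simp: rev_vertex_def)
    from e show "(\<Sum>k<2*n. ?q i k * w1 k) = w1 i" "(\<Sum>k<2*n. ?q i k * w2 k) = w2 i"
      "(\<Sum>k<2*n. ?q i k * w3 k) = - ?e * w4 i" "(\<Sum>k<2*n. ?q i k * w4 k) = - ?e * w3 i"
      unfolding sum_reflection_left[OF that] w edge_vec_def
        rev[OF that] rev[OF swap_rev_simps(1)[OF that]] swap
      by (elim disjE; simp)+
  qed
  have QP: "(\<Sum>k<2*n. ?q i k * ?P $$ (k, j)) = (\<Sum>k<2*n. ?P $$ (i, k) * ?q k j)"
    using ij by (simp add: sum_reflection_left sum_reflection_right two_paths_laplacian_symmetry)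
  have wQ: "(\<Sum>k<2*n. f k * ?q k j) = (\<Sum>k<2*n. ?q j k * f k)" for f :: "nat \<Rightarrow> real"
    using ij by (simp add: sum_reflection_left sum_reflection_right)
  have "(\<Sum>k<2*n. ?q i k * sg_laplacian n (two_cycles n e) $$ (k, j)) =
     (\<Sum>k<2*n. ?q i k * ?P $$ (k, j)) + (\<Sum>k<2*n. ?q i k * w1 k) * w1 j
      + (\<Sum>k<2*n. ?q i k * w2 k) * w2 j + (\<Sum>k<2*n. ?q i k * w3 k) * w3 j"
    unfolding sum_distrib_right sum.distrib[symmetric]
    using ij by (intro sum.cong) (auto simp: L algebra_simps)
  \<comment> \<open>For the last edge, Q w3 w3^T = - e w4 w3^T = w4 (Q w4)^T, because Q w4 = - e w3;
    \<open>wQ\<close> uses the symmetry of Q to put it on the right.\<close>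
  also have "\<dots> = (\<Sum>k<2*n. ?P $$ (i, k) * ?q k j) + w1 i * (\<Sum>k<2*n. w1 k * ?q k j)
      + w2 i * (\<Sum>k<2*n. w2 k * ?q k j) + w4 i * (\<Sum>k<2*n. w4 k * ?q k j)"
    using ij by (simp add: QP wQ Qw)
  also have "\<dots> = (\<Sum>k<2*n. sg_laplacian n (two_cycles_transposed n e) $$ (i, k) * ?q k j)"
    unfolding sum_distrib_left sum.distrib[symmetric]
    using ij by (intro sum.cong) (auto simp: L algebra_simps)
  finally show "(\<Sum>k<2*n. ?q i k * sg_laplacian n (two_cycles n e) $$ (k, j)) =
    (\<Sum>k<2*n. sg_laplacian n (two_cycles_transposed n e) $$ (i, k) * ?q k j)" .
qed simp_all

section \<open>A degree obstruction, adjacency blocks and switching to the model graphs\<close>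

text \<open>An isomorphism \<open>f\<close> embeds the neighbourhood of \<open>x\<close> into that
  of \<open>f x\<close>, whose degree would therefore be too large.\<close>

lemma not_sg_iso_by_degree:
  assumes x: "x < 2*n" and lt: "\<And>y. y < 2*n \<Longrightarrow>
      card {k. k < 2*n \<and> B y k \<noteq> 0} < card {k. k < 2*n \<and> A x k \<noteq> 0}"
  shows "\<not> sg_iso n A B"
proof
  assume "sg_iso n A B"
  then obtain f where f: "bij_betw f {0..<2*n} {0..<2*n}"
    and B: "\<And>x y. x < 2*n \<Longrightarrow> y < 2*n \<Longrightarrow> B (f x) (f y) = A x y"
    by (auto simp: sg_iso_def)
  have fl: "f k < 2*n" if "k < 2*n" for k using f that by (auto dest: bij_betwE)
  have "card {k. k < 2*n \<and> A x k \<noteq> 0} \<le> card {k. k < 2*n \<and> B (f x) k \<noteq> 0}"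
  proof (rule card_inj_on_le)
    show "inj_on f {k. k < 2*n \<and> A x k \<noteq> 0}"
      using f by (auto simp: bij_betw_def intro: inj_on_subset)
  qed (use x fl B in auto)
  with lt[OF fl[OF x]] show False by simp
qed

lemma two_cycles_blocks:
  assumes n: "n \<ge> 3" and "x < n" "y < n"
  shows "two_cycles n e x y = (if x = 0 \<and> y = n - 1 \<or> x = n - 1 \<and> y = 0 then e
      else if x = y + 1 \<or> y = x + 1 then 1 else 0)"
    and "two_cycles n e x (n + y) = (if x = 0 \<and> y = 0 then -1 else if x = 0 \<and> y = n - 1 then e else 0)"
    and "two_cycles n e (n + y) x = (if x = 0 \<and> y = 0 then -1 else if x = 0 \<and> y = n - 1 then e else 0)"
    and "two_cycles n e (n + x) (n + y) = (if x = y + 1 \<or> y = x + 1 then 1 else 0)"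
proof -
  have ne: "n + y = 2*n-1 \<longleftrightarrow> y = n - 1" "x \<noteq> 2*n-1" "y \<noteq> 2*n-1" "n + y \<noteq> n - 1" "n + x \<noteq> n - 1"
    "n + y \<noteq> 0" "n + x \<noteq> 0" "x \<noteq> n" "y \<noteq> n" "n - 1 \<noteq> 0" "2*n-1 \<noteq> 0" "2*n-1 \<noteq> n"
    using assms by auto
  show "two_cycles n e x y = (if x = 0 \<and> y = n - 1 \<or> x = n - 1 \<and> y = 0 then e
      else if x = y + 1 \<or> y = x + 1 then 1 else 0)"
    "two_cycles n e x (n + y) = (if x = 0 \<and> y = 0 then -1 else if x = 0 \<and> y = n - 1 then e else 0)"
    "two_cycles n e (n + y) x = (if x = 0 \<and> y = 0 then -1 else if x = 0 \<and> y = n - 1 then e else 0)"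
    "two_cycles n e (n + x) (n + y) = (if x = y + 1 \<or> y = x + 1 then 1 else 0)"
    using assms unfolding two_cycles_def set_edge_def two_paths_def by (simp_all add: ne del: One_nat_def)
qed

lemma two_cycles_transposed_blocks:
  assumes n: "n \<ge> 3" and "x < n" "y < n"
  shows "two_cycles_transposed n e x y = (if x = 0 \<and> y = n - 1 \<or> x = n - 1 \<and> y = 0 then e
      else if x = y + 1 \<or> y = x + 1 then 1 else 0)"
    and "two_cycles_transposed n e x (n + y) =
      (if x = 0 \<and> y = 0 then -1 else if x = n - 1 \<and> y = 0 then e else 0)"
    and "two_cycles_transposed n e (n + y) x =
      (if x = 0 \<and> y = 0 then -1 else if x = n - 1 \<and> y = 0 then e else 0)"
    and "two_cycles_transposed n e (n + x) (n + y) = (if x = y + 1 \<or> y = x + 1 then 1 else 0)"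
proof -
  have ne: "n + y \<noteq> n - 1" "n + x \<noteq> n - 1" "n + y \<noteq> 0" "n + x \<noteq> 0" "x \<noteq> n" "y \<noteq> n" "n - 1 \<noteq> 0"
    using assms by auto
  show "two_cycles_transposed n e x y = (if x = 0 \<and> y = n - 1 \<or> x = n - 1 \<and> y = 0 then e
      else if x = y + 1 \<or> y = x + 1 then 1 else 0)"
    "two_cycles_transposed n e x (n + y) =
      (if x = 0 \<and> y = 0 then -1 else if x = n - 1 \<and> y = 0 then e else 0)"
    "two_cycles_transposed n e (n + y) x =
      (if x = 0 \<and> y = 0 then -1 else if x = n - 1 \<and> y = 0 then e else 0)"
    "two_cycles_transposed n e (n + x) (n + y) = (if x = y + 1 \<or> y = x + 1 then 1 else 0)"
    using assms unfolding two_cycles_transposed_def set_edge_def two_paths_def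
    by (simp_all add: ne del: One_nat_def)
qed

text \<open>Puts vertices of the second path into the form \<open>n + i'\<close> in which the block
  formulas are stated.\<close>

lemma vertex_cases:
  fixes i n :: nat
  assumes "i < 2*n"
  obtains "i < n" | i' where "i' < n" "i = n + i'"
proof (cases "i < n")
  case False
  then have "i - n < n" "i = n + (i - n)" using assms by auto
  then show thesis by (rule that(2))
qed (rule that(1))

text \<open>Only u_1v_n moves, to u_nv_1; the edge u_1v_1 joins equal indices and stays.\<close>

lemma partial_transpose_two_cycles:
  assumes n: "n \<ge> 3" and x: "x < 2*n" and y: "y < 2*n"
  shows "partial_transpose n (two_cycles n e) x y = two_cycles_transposed n e x y"
  using x
proof (cases rule: vertex_cases)
  case 1
  from y 1 n show ?thesis
    by (cases rule: vertex_cases)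
      (auto simp: partial_transpose_def two_cycles_blocks two_cycles_transposed_blocks add.commute[of _ n])
next
  case 2
  from y 2 n show ?thesis
    by (cases rule: vertex_cases)
      (auto simp: partial_transpose_def two_cycles_blocks two_cycles_transposed_blocks add.commute[of _ n])
qed

lemma Gamma1_eq_two_cycles: "Gamma1 n = two_cycles n 1"
  by (simp add: Gamma1_def two_cycles_def uu_def vv_def mult_2)

text \<open>Switching at u_n and all of V_2 makes the three added edges positive and, among the path
  edges, negates just u_(n-1)u_n.\<close>

lemma Gamma2_eq_switched:
  fixes n :: nat
  defines "s \<equiv> \<lambda>i. if i = n - 1 \<or> n \<le> i then -1 else 1"
  assumes n: "n \<ge> 3" and x: "x < 2*n" and y: "y < 2*n"
  shows "Gamma2 n x y = s x * s y * two_cycles n (-1) x y"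
  using x
proof (cases rule: vertex_cases)
  case 1
  from y 1 n show ?thesis
    by (cases rule: vertex_cases)
      (auto simp: Gamma2_def Gamma1_eq_two_cycles uu_def vv_def set_edge_def two_cycles_blocks s_def)
next
  case x': (2 x')
  from y show ?thesis
  proof (cases rule: vertex_cases)
    case 1
    with x' n show ?thesis
      by (auto simp: Gamma2_def Gamma1_eq_two_cycles uu_def vv_def set_edge_def two_cycles_blocks s_def)
  next
    case (2 y')
    have "Gamma2 n (n + x') (n + y') = two_cycles n 1 (n + x') (n + y')"
      using n by (auto simp: Gamma2_def Gamma1_eq_two_cycles uu_def vv_def set_edge_def)
    with 2 x' n show ?thesis
      by (simp add: two_cycles_blocks s_def)
  qed
qed

text \<open>Switching at u_n alone negates its three edges: u_1u_n and u_nv_1 become positive,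
  u_(n-1)u_n becomes negative, and u_1v_1 stays negative.\<close>

lemma Gamma3_eq_switched:
  fixes n :: nat
  defines "s \<equiv> \<lambda>i. if i = n - 1 then -1 else 1"
  assumes n: "n \<ge> 3" and x: "x < 2*n" and y: "y < 2*n"
  shows "Gamma3 n x y = s x * s y * two_cycles_transposed n (-1) x y"
proof -
  have uu: "uu (n - 1) = n - 2" "uu n = n - 1" by (simp_all add: uu_def)
  have G3: "Gamma3 n x y = set_edge (two_cycles_transposed n 1) (n - 2) (n - 1) (-1) x y"
    using partial_transpose_two_cycles[OF n x y, of 1]
    unfolding Gamma3_def Gamma1_eq_two_cycles uu set_edge_def by simp
  from x show ?thesis
  proof (cases rule: vertex_cases)
    case 1
    from y 1 n show ?thesis
      unfolding G3
      by (cases rule: vertex_cases)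
        (auto simp: set_edge_def two_cycles_transposed_blocks s_def)
  next
    case x': (2 x')
    from y show ?thesis
    proof (cases rule: vertex_cases)
      case 1
      with x' n show ?thesis
        unfolding G3
        by (auto simp: set_edge_def two_cycles_transposed_blocks s_def)
    next
      case (2 y')
      have "n + x' \<noteq> n - 1" "n + y' \<noteq> n - 1" using n by auto
      moreover from this have "Gamma3 n x y = two_cycles_transposed n 1 (n + x') (n + y')"
        unfolding G3 by (simp add: 2 x' set_edge_def)
      ultimately show ?thesis
        using 2 x' n by (simp add: two_cycles_transposed_blocks s_def)
    qed
  qed
qed

section \<open>Maximum degrees and conclusion\<close>

text \<open>The vertex u_1 is adjacent to u_2, u_n, v_1 and v_n, which are distinct because n >= 3
  separates u_2 from u_n.\<close>

lemma degree_two_cycles: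
  assumes n: "n \<ge> 3" and e: "e \<noteq> 0"
  shows "card {k. k < 2*n \<and> two_cycles n e 0 k \<noteq> 0} \<ge> 4"
proof -
  have "two_cycles n e 0 1 \<noteq> 0" "two_cycles n e 0 (n-1) \<noteq> 0" "two_cycles n e 0 n \<noteq> 0"
      "two_cycles n e 0 (2*n-1) \<noteq> 0"
    using n e by (auto simp: two_cycles_def set_edge_def two_paths_def)
  then have "{1, n-1, n, 2*n-1} \<subseteq> {k. k < 2*n \<and> two_cycles n e 0 k \<noteq> 0}"
    using n by auto
  then have "card {1, n-1, n, 2*n-1} \<le> card {k. k < 2*n \<and> two_cycles n e 0 k \<noteq> 0}"
    by (rule card_mono[rotated]) simp
  moreover have "card {1, n-1, n, 2*n-1} = 4"
    using n by (auto simp: card_insert_if)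
  ultimately show ?thesis by simp
qed

lemma degree_two_cycles_transposed:
  assumes n: "n \<ge> 3" and x: "x < 2*n"
  shows "card {k. k < 2*n \<and> two_cycles_transposed n e x k \<noteq> 0} < 4"
proof -
  \<comment> \<open>A superset of the neighbourhood of \<open>x\<close>. The vertices u_1, u_n, v_1
    form a triangle and have one path neighbour each; every other vertex has only path
    neighbours.\<close>
  let ?S = "if x = 0 then {1, n-1, n} else if x = n-1 then {0, n-2, n}
       else if x = n then {0, n-1, n+1} else {x-1, x+1}"
  have "k \<in> ?S" if "k < 2*n" "two_cycles_transposed n e x k \<noteq> 0" for k
  proof -
    have "x = 0 \<and> (k = n - 1 \<or> k = n) \<or> x = n - 1 \<and> (k = 0 \<or> k = n) \<or> x = n \<and> (k = 0 \<or> k = n - 1)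
        \<or> two_paths n x k \<noteq> 0"
      using that(2) by (auto simp: two_cycles_transposed_def set_edge_def split: if_splits)
    moreover have "(x < n \<longleftrightarrow> k < n) \<and> (x = k + 1 \<or> k = x + 1)" if "two_paths n x k \<noteq> 0"
      using that by (auto simp: two_paths_def split: if_splits)
    ultimately show ?thesis using n by auto
  qed
  then have "{k. k < 2*n \<and> two_cycles_transposed n e x k \<noteq> 0} \<subseteq> ?S"
    by blast
  then have "card {k. k < 2*n \<and> two_cycles_transposed n e x k \<noteq> 0} \<le> card ?S"
    by (rule card_mono[rotated]) simp
  also have "card ?S < 4" by (auto simp: card_insert_if)
  finally show ?thesis .
qed

theorem theorem3p1:
  fixes n :: nat
  assumes "n \<ge> 3"
  shows "(\<not> sg_iso n (Gamma1 n) (partial_transpose n (Gamma1 n))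
            \<and> lap_cospectral n (Gamma1 n) (partial_transpose n (Gamma1 n)))
       \<and> (\<not> sg_iso n (Gamma2 n) (Gamma3 n) \<and> lap_cospectral n (Gamma2 n) (Gamma3 n))"
proof -
  define s2 s3 :: "nat \<Rightarrow> int" where
    s: "s2 = (\<lambda>i. if i = n - 1 \<or> n \<le> i then -1 else 1)" "s3 = (\<lambda>i. if i = n - 1 then -1 else 1)"
  have ss: "s2 i * s2 i = 1" "s3 i * s3 i = 1" for i by (auto simp: s)
  have s0: "s2 i \<noteq> 0" "s3 i \<noteq> 0" for i by (auto simp: s)
  note G1 = Gamma1_eq_two_cycles
  have T1: "partial_transpose n (Gamma1 n) x y = two_cycles_transposed n 1 x y" if "x < 2*n" "y < 2*n" for x y
    unfolding G1 by (rule partial_transpose_two_cycles) (fact assms that)+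
  have G2: "Gamma2 n x y = s2 x * s2 y * two_cycles n (-1) x y" if "x < 2*n" "y < 2*n" for x y
    unfolding s by (rule Gamma2_eq_switched) (fact assms that)+
  have G3: "Gamma3 n x y = s3 x * s3 y * two_cycles_transposed n (-1) x y" if "x < 2*n" "y < 2*n" for x y
    unfolding s by (rule Gamma3_eq_switched) (fact assms that)+
  have "sg_laplacian n (partial_transpose n (Gamma1 n)) = sg_laplacian n (two_cycles_transposed n 1)"
    by (rule sg_laplacian_cong) (rule T1)
  then have "lap_cospectral n (Gamma1 n) (partial_transpose n (Gamma1 n))"
    using two_cycles_cospectral[of n 1] assms by (simp add: G1 lap_cospectral_def)
  moreover have "\<not> sg_iso n (Gamma1 n) (partial_transpose n (Gamma1 n))"
  proof (rule not_sg_iso_by_degree[of 0])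
    fix y assume y: "y < 2*n"
    have "{k. k < 2*n \<and> partial_transpose n (Gamma1 n) y k \<noteq> 0} =
        {k. k < 2*n \<and> two_cycles_transposed n 1 y k \<noteq> 0}"
      using y by (intro Collect_cong) (auto simp: T1)
    then show "card {k. k < 2*n \<and> partial_transpose n (Gamma1 n) y k \<noteq> 0} < card {k. k < 2*n \<and> Gamma1 n 0 k \<noteq> 0}"
      using degree_two_cycles_transposed[OF assms y, of 1] degree_two_cycles[OF assms, of 1]
      by (simp add: G1)
  qed (use assms in simp)
  \<comment> \<open>Both graphs are switched back to the model graphs with e = -1, which are
    cospectral.\<close>
  moreover have "lap_cospectral n (Gamma2 n) (Gamma3 n)"
    using two_cycles_cospectral[of n "-1"] assms
      lap_cospectral_switching[OF ss(1) G2] lap_cospectral_switching[OF ss(2) G3]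
    by (simp add: lap_cospectral_def)
  moreover have "\<not> sg_iso n (Gamma2 n) (Gamma3 n)"
  proof (rule not_sg_iso_by_degree[of 0])
    fix y assume y: "y < 2*n"
    \<comment> \<open>Switching keeps the underlying graph, so the degree bounds of the model graphs
      apply.\<close>
    have "{k. k < 2*n \<and> Gamma2 n 0 k \<noteq> 0} = {k. k < 2*n \<and> two_cycles n (-1) 0 k \<noteq> 0}"
      using y by (intro Collect_cong) (auto simp: G2 s0)
    moreover have "{k. k < 2*n \<and> Gamma3 n y k \<noteq> 0} = {k. k < 2*n \<and> two_cycles_transposed n (-1) y k \<noteq> 0}"
      using y by (intro Collect_cong) (auto simp: G3 s0)
    ultimately show "card {k. k < 2*n \<and> Gamma3 n y k \<noteq> 0} < card {k. k < 2*n \<and> Gamma2 n 0 k \<noteq> 0}"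
      using degree_two_cycles_transposed[OF assms y, of "-1"] degree_two_cycles[OF assms, of "-1"]
      by simp
  qed (use assms in simp)
  ultimately show ?thesis by blast
qed

end
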